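(* Let $\ell$ be a prime, $G$ a finite abelian group and $S\subseteq G$ a subset with $S$ generating $G$, $S=S^{-1}$ and $1\notin S$; put $r=\#S$ and assume $r\notin\{1,2\}$. Let $X=\mathrm{Cay}(G,S)$, let $\beta:S\to\mathbb{Z}_\ell$ satisfy conditions (1)–(4) below, and let $\alpha=\alpha_\beta$ be the associated voltage assignment. Then \[ f_{X,\alpha}(T)\sim \prod_{\psi\in\widehat{G}} P_\psi(T), \] i.e. $f_{X,\alpha}(T)$ equals $\prod_{\psi\in\widehat G}P_\psi(T)$ times a unit of $\mathcal{O}[\![T]\!]$.
   Context: $\mathrm{Cay}(G,S)$ is the graph with vertex set $\{v_g:g\in G\}$ having, for each ordered pair $(g_1,g_2)$ with $g_1g_2^{-1}\in S$, one directed edge $e(g_1,g_2)$ from $v_{g_1}$ to $v_{g_2}$ (its inverse edge being $e(g_2,g_1)$); it has no loops and every vertex has degree $r$. (The paper's standing assumption that $X$ is connected, has no vertex of degree $1$, and has nonzero Euler characteristic $\#V-\#E$, with $E$ the undirected edges, amounts to $r\notin\{1,2\}$.) The conditions on $\beta:S\to\mathbb{Z}_\ell$ are: (1) the image of $\beta$ generates $\mathbb{Z}_\ell$ as a $\mathbb{Z}_\ell$-module; (2) $\beta(s^{-1})=-\beta(s)$ for all $s\in S$; (3) $\beta(S)\subseteq\mathbb{Z}$; (4) there exist $m>0$ and $(h_1,\dots,h_m)\in S^m$ with $h_1\cdots h_m\in S$ and $\beta(h_1\cdots h_m)\not\equiv\sum_{i=1}^m\beta(h_i)\pmod{\ell}$.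 The voltage assignment is $\alpha(e(g_1,g_2)):=\beta(g_1g_2^{-1})$. Enumerate $G=\{g_1,\dots,g_n\}$ and let $\delta_S(g)=1$ if $g\in S$, $0$ otherwise. For $b\in\mathbb{Z}$, $(1+T)^b$ denotes the (unit) power series $\sum_{k\ge0}\binom{b}{k}T^k$. The Iwasawa polynomial is $f_{X,\alpha}(T)=\det\big(r\,\delta_{ij}-\delta_S(g_ig_j^{-1})(1+T)^{\beta(g_ig_j^{-1})}\big)_{i,j}\in\mathbb{Z}_\ell[\![T]\!]$. Let $\widehat G=\mathrm{Hom}(G,\mathbb{C}^\times)$; fix an embedding $\overline{\mathbb{Q}}\hookrightarrow\overline{\mathbb{Q}}_\ell$, let $K\subset\overline{\mathbb{Q}}_\ell$ be the field generated over $\mathbb{Q}_\ell$ by the $|G|$-th roots of unity and $\mathcal{O}$ its valuation ring, so every $\psi\in\widehat G$ takes values in $\mathcal{O}^\times$. With $m_\beta:=\max\{\beta(s):s\in S\}$, define $P_\psi(T):=r(1+T)^{m_\beta}-\sum_{s\in S}\psi(s)(1+T)^{m_\beta-\beta(s)}\in\mathcal{O}[T]$. *)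

theory Defs
  imports
    Complex_Main
    "HOL-Algebra.Algebraic_Closure_Type"
    "HOL-Algebra.Generated_Fields"
    "HOL-Algebra.Generated_Groups"
    "HOL-Computational_Algebra.Fraction_Field"
    "HOL-Computational_Algebra.Formal_Power_Series"
    "HOL-Computational_Algebra.Polynomial_FPS"
    "Berlekamp_Zassenhaus.Finite_Field"
    "Jordan_Normal_Form.Determinant"
    "Graph_Theory.Digraph"
    "HOL.Binomial_Plus"
begin

section \<open>The ring of \<open>\<ell>\<close>-adic integers\<close>

text \<open>The prime \<open>\<ell>\<close> is \<open>CARD('p)\<close> for a type variable \<open>'p\<close> of class \<open>prime_card\<close>.
  The ring \<open>\<int>\<^sub>\<ell>\<close> is the inverse limit of the rings \<open>\<int>/\<ell>\<^sup>n\<close>; residue classes are represented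
  by their representatives in \<open>{0..<\<ell>\<^sup>n}\<close> (the compatibility condition forces this range).\<close>

typedef 'p padic_int =
  "{x :: nat \<Rightarrow> int. \<forall>n. x (Suc n) mod int CARD('p) ^ n = x n}"
  by (rule exI[of _ "\<lambda>_. 0"]) simp

setup_lifting type_definition_padic_int

lemma mod_power_Suc: "(a mod (b::int) ^ Suc n) mod b ^ n = a mod b ^ n"
  by (rule mod_mod_cancel) (simp add: le_imp_power_dvd)

lemma compatible_mod: "\<forall>n. x (Suc n) mod (b::int) ^ n = x n \<Longrightarrow> x n mod b ^ n = x n"
  by (metis mod_mod_trivial)

instantiation padic_int :: (prime_card) comm_ring_1
begin

lift_definition zero_padic_int :: "'a padic_int" is "\<lambda>_. 0" by simp

lift_definition one_padic_int :: "'a padic_int" is "\<lambda>n. 1 mod int CARD('a) ^ n"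
  by (simp only: mod_power_Suc)

lift_definition plus_padic_int :: "'a padic_int \<Rightarrow> 'a padic_int \<Rightarrow> 'a padic_int"
  is "\<lambda>x y n. (x n + y n) mod int CARD('a) ^ n"
  by (simp only: mod_power_Suc) (metis mod_add_eq)

lift_definition uminus_padic_int :: "'a padic_int \<Rightarrow> 'a padic_int"
  is "\<lambda>x n. (- x n) mod int CARD('a) ^ n"
  by (simp only: mod_power_Suc) (metis mod_minus_eq)

lift_definition minus_padic_int :: "'a padic_int \<Rightarrow> 'a padic_int \<Rightarrow> 'a padic_int"
  is "\<lambda>x y n. (x n - y n) mod int CARD('a) ^ n"
  by (simp only: mod_power_Suc) (metis mod_diff_eq)

lift_definition times_padic_int :: "'a padic_int \<Rightarrow> 'a padic_int \<Rightarrow> 'a padic_int"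
  is "\<lambda>x y n. (x n * y n) mod int CARD('a) ^ n"
  by (simp only: mod_power_Suc) (metis mod_mult_eq)

instance
proof
  fix a b c :: "'a padic_int"
  show "a * b * c = a * (b * c)"
    by transfer (auto simp: fun_eq_iff mod_simps mult.assoc)
  show "a * b = b * a"
    by transfer (auto simp: fun_eq_iff mult.commute)
  show "1 * a = a"
    by transfer (auto simp: fun_eq_iff mod_simps compatible_mod)
  show "a + b + c = a + (b + c)"
    by transfer (auto simp: fun_eq_iff mod_simps add.assoc)
  show "a + b = b + a"
    by transfer (auto simp: fun_eq_iff add.commute)
  show "0 + a = a"
    by transfer (auto simp: fun_eq_iff compatible_mod)
  show "- a + a = 0"
    by transfer (auto simp: fun_eq_iff mod_simps)
  show "a - b = a + - b"
    by transfer (auto simp: fun_eq_iff mod_simps)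
  show "(a + b) * c = a * c + b * c"
    by transfer (auto simp: fun_eq_iff mod_simps distrib_right)
  have "(0::int) \<noteq> 1 mod int CARD('a) ^ 1"
    using prime_gt_1_nat[OF prime_card[where 'a='a]] by simp
  then show "(0::'a padic_int) \<noteq> 1"
    by transfer (metis)
qed

end

lemma Rep_padic_int_of_nat: "Rep_padic_int (of_nat k :: 'p::prime_card padic_int) n = int k mod int CARD('p) ^ n"
proof (induction k)
  case 0
  show ?case by (simp add: zero_padic_int.rep_eq)
next
  case (Suc k)
  then show ?case
    by (simp add: plus_padic_int.rep_eq one_padic_int.rep_eq mod_add_eq)
qed

lemma Rep_padic_int_mod:
  "Rep_padic_int (x :: 'p padic_int) (n + k) mod int CARD('p) ^ n = Rep_padic_int x n"
proof (induction k)
  case 0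
  show ?case using Rep_padic_int[of x] by (simp, metis mod_mod_trivial)
next
  case (Suc k)
  have "Rep_padic_int x (n + k) = Rep_padic_int x (Suc (n + k)) mod int CARD('p) ^ (n + k)"
    using Rep_padic_int[of x] by simp
  then have "Rep_padic_int x (n + k) mod int CARD('p) ^ n = Rep_padic_int x (Suc (n + k)) mod int CARD('p) ^ n"
    by (simp add: mod_mod_cancel le_imp_power_dvd)
  with Suc show ?case by simp
qed

lemma prime_power_dvd_padic_int_iff:
  fixes x :: "'p::prime_card padic_int"
  shows "of_nat CARD('p) ^ n dvd x \<longleftrightarrow> Rep_padic_int x n = 0"
proof
  assume "of_nat CARD('p) ^ n dvd x"
  then obtain y where y: "x = of_nat (CARD('p) ^ n) * y" by auto
  show "Rep_padic_int x n = 0"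
    unfolding y times_padic_int.rep_eq Rep_padic_int_of_nat by simp
next
  assume *: "Rep_padic_int x n = 0"
  let ?q = "int CARD('p)"
  have q: "?q > 0" using prime_gt_0_nat[OF prime_card[where 'a='p]] by simp
  define y where "y = (\<lambda>k. Rep_padic_int x (n + k) div ?q ^ n)"
  have dvd: "?q ^ n dvd Rep_padic_int x (n + k)" for k
    using Rep_padic_int_mod[of x n k] * by auto
  have y_eq: "y (Suc k) mod ?q ^ k = y k" for k
  proof -
    have "Rep_padic_int x (n + k) = Rep_padic_int x (n + Suc k) mod (?q ^ n * ?q ^ k)"
      using Rep_padic_int[of x] by (simp flip: power_add)
    also have "\<dots> = ?q ^ n * (y (Suc k) mod ?q ^ k)"
      using dvd[of "Suc k"] by (simp add: y_def mult_mod_right)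
    finally show ?thesis using q by (simp add: y_def)
  qed
  have Ry: "Rep_padic_int (Abs_padic_int y :: 'p padic_int) = y"
    using y_eq by (intro Abs_padic_int_inverse) simp
  have "x = of_nat (CARD('p) ^ n) * Abs_padic_int y"
  proof (rule iffD1[OF Rep_padic_int_inject], rule ext)
    fix k
    have "Rep_padic_int (of_nat (CARD('p) ^ n) * Abs_padic_int y :: 'p padic_int) k
        = (?q ^ n * y k) mod ?q ^ k"
      by (simp only: times_padic_int.rep_eq Rep_padic_int_of_nat Ry) (simp add: mod_simps)
    also have "?q ^ n * y k = Rep_padic_int x (k + n)"
      using dvd[of k] by (simp add: y_def add.commute)
    also have "\<dots> mod ?q ^ k = Rep_padic_int x k" by (rule Rep_padic_int_mod)
    finally show "Rep_padic_int x k =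
      Rep_padic_int (of_nat (CARD('p) ^ n) * Abs_padic_int y :: 'p padic_int) k" ..
  qed
  then show "of_nat CARD('p) ^ n dvd x" by (metis dvd_triv_left of_nat_power)
qed

definition padic_val :: "'p::prime_card padic_int \<Rightarrow> nat" where
  "padic_val x = Max {n. of_nat CARD('p) ^ n dvd x}"

lemma finite_padic_val_set:
  fixes x :: "'p::prime_card padic_int"
  assumes "x \<noteq> 0"
  shows "finite {n. of_nat CARD('p) ^ n dvd x}"
proof -
  from assms obtain m where m: "Rep_padic_int x m \<noteq> 0"
    by (metis (no_types) Rep_padic_int_inject zero_padic_int.rep_eq ext)
  have "n < m" if "of_nat CARD('p) ^ n dvd x" for n
  proof (rule ccontr)
    assume "\<not> n < m"
    then have "of_nat CARD('p) ^ m dvd x" using that by (meson dvd_trans le_imp_power_dvd not_less)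
    with m show False by (simp add: prime_power_dvd_padic_int_iff)
  qed
  then show ?thesis by (metis (no_types, lifting) finite_nat_set_iff_bounded mem_Collect_eq)
qed

lemma padic_val_dvd_iff:
  fixes x :: "'p::prime_card padic_int"
  assumes "x \<noteq> 0"
  shows "of_nat CARD('p) ^ n dvd x \<longleftrightarrow> n \<le> padic_val x"
proof
  assume "of_nat CARD('p) ^ n dvd x"
  then show "n \<le> padic_val x"
    unfolding padic_val_def using finite_padic_val_set[OF assms] by (intro Max_ge) auto
next
  assume n: "n \<le> padic_val x"
  have "padic_val x \<in> {n. of_nat CARD('p) ^ n dvd x}"
    unfolding padic_val_def by (rule Max_in[OF finite_padic_val_set[OF assms]]) (auto intro: exI[of _ 0])
  with n show "of_nat CARD('p) ^ n dvd x" by (meson dvd_trans le_imp_power_dvd mem_Collect_eq)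
qed

lemma padic_int_decomp:
  fixes x :: "'p::prime_card padic_int"
  assumes "x \<noteq> 0"
  obtains u where "x = of_nat CARD('p) ^ padic_val x * u" "\<not> of_nat CARD('p) dvd u"
proof -
  obtain u where u: "x = of_nat CARD('p) ^ padic_val x * u"
    using padic_val_dvd_iff[OF assms, of "padic_val x"] by (auto elim: dvdE)
  have "\<not> of_nat CARD('p) dvd u"
  proof
    assume "of_nat CARD('p) dvd u"
    then have "of_nat CARD('p) ^ Suc (padic_val x) dvd x"
      by (subst u) (simp add: mult.commute mult_dvd_mono)
    then show False using padic_val_dvd_iff[OF assms, of "Suc (padic_val x)"] by simp
  qed
  with u that show thesis by blast
qed

lemma prime_dvd_mult_padic_int:
  fixes x y :: "'p::prime_card padic_int"
  assumes "of_nat CARD('p) dvd x * y"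
  shows "of_nat CARD('p) dvd x \<or> of_nat CARD('p) dvd y"
proof -
  have p: "Factorial_Ring.prime (int CARD('p))" using prime_card_int[where 'a='p] .
  have r: "Rep_padic_int z 1 mod int CARD('p) = Rep_padic_int z 1" for z :: "'p padic_int"
    using Rep_padic_int_mod[of z 1 0] by simp
  have "Rep_padic_int (x * y) 1 = 0"
    using assms prime_power_dvd_padic_int_iff[of 1 "x * y"] by simp
  then have "int CARD('p) dvd Rep_padic_int x 1 * Rep_padic_int y 1"
    by (simp add: times_padic_int.rep_eq dvd_eq_mod_eq_0)
  then have "int CARD('p) dvd Rep_padic_int x 1 \<or> int CARD('p) dvd Rep_padic_int y 1"
    using p by (simp add: prime_dvd_mult_iff)
  then have "Rep_padic_int x 1 = 0 \<or> Rep_padic_int y 1 = 0"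
    using r by (metis dvd_imp_mod_0)
  then show ?thesis
    using prime_power_dvd_padic_int_iff[of 1 x] prime_power_dvd_padic_int_iff[of 1 y] by simp
qed

lemma prime_power_cancel_padic_int:
  fixes x :: "'p::prime_card padic_int"
  shows "of_nat CARD('p) ^ (k + n) dvd of_nat CARD('p) ^ k * x \<longleftrightarrow> of_nat CARD('p) ^ n dvd x"
proof
  let ?q = "int CARD('p)"
  have q: "?q > 0" using prime_gt_0_nat[OF prime_card[where 'a='p]] by simp
  assume "of_nat CARD('p) ^ (k + n) dvd of_nat CARD('p) ^ k * x"
  then have "of_nat CARD('p) ^ (k + n) dvd of_nat (CARD('p) ^ k) * x" by simp
  then have "Rep_padic_int (of_nat (CARD('p) ^ k) * x) (n + k) = 0"
    by (simp only: prime_power_dvd_padic_int_iff add.commute)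
  then have "(?q ^ k * Rep_padic_int x (n + k)) mod (?q ^ (n + k)) = 0"
    by (simp only: times_padic_int.rep_eq Rep_padic_int_of_nat) (simp add: mod_simps)
  then have "?q ^ k * ?q ^ n dvd ?q ^ k * Rep_padic_int x (n + k)"
    by (simp add: dvd_eq_mod_eq_0 power_add mult.commute)
  then have "?q ^ n dvd Rep_padic_int x (n + k)" using q by simp
  then show "of_nat CARD('p) ^ n dvd x"
    using Rep_padic_int_mod[of x n k] by (simp add: prime_power_dvd_padic_int_iff)
next
  assume "of_nat CARD('p) ^ n dvd x"
  then show "of_nat CARD('p) ^ (k + n) dvd of_nat CARD('p) ^ k * x"
    by (simp add: power_add mult_dvd_mono)
qed

lemma padic_val_mult_aux:
  fixes x y :: "'p::prime_card padic_int"
  assumes "x \<noteq> 0" "y \<noteq> 0"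
  shows "of_nat CARD('p) ^ n dvd x * y \<longleftrightarrow> n \<le> padic_val x + padic_val y"
proof -
  obtain u where u: "x = of_nat CARD('p) ^ padic_val x * u" "\<not> of_nat CARD('p) dvd u"
    using padic_int_decomp[OF assms(1)] .
  obtain v where v: "y = of_nat CARD('p) ^ padic_val y * v" "\<not> of_nat CARD('p) dvd v"
    using padic_int_decomp[OF assms(2)] .
  let ?k = "padic_val x + padic_val y"
  have "x * y = (of_nat CARD('p) ^ padic_val x * u) * (of_nat CARD('p) ^ padic_val y * v)"
    by (rule arg_cong2[where f = "(*)", OF u(1) v(1)])
  then have xy: "x * y = of_nat CARD('p) ^ ?k * (u * v)"
    by (simp only: power_add ac_simps)
  have no: "\<not> of_nat CARD('p) ^ (?k + 1) dvd x * y"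
    unfolding xy prime_power_cancel_padic_int using prime_dvd_mult_padic_int u(2) v(2) by auto
  have yes: "of_nat CARD('p) ^ ?k dvd x * y" unfolding xy by (rule dvd_triv_left)
  show ?thesis
  proof
    assume "of_nat CARD('p) ^ n dvd x * y"
    then show "n \<le> ?k"
      using no by (metis Suc_eq_plus1 dvd_trans le_imp_power_dvd not_less_eq_eq)
  next
    assume "n \<le> ?k"
    then show "of_nat CARD('p) ^ n dvd x * y"
      using yes by (meson dvd_trans le_imp_power_dvd)
  qed
qed

instance padic_int :: (prime_card) idom
proof
  fix x y :: "'a padic_int"
  assume "x \<noteq> 0" "y \<noteq> 0"
  then have "\<not> of_nat CARD('a) ^ (Suc (padic_val x + padic_val y)) dvd x * y"
    using padic_val_mult_aux[of x y "Suc (padic_val x + padic_val y)"] by simp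
  then show "x * y \<noteq> 0" by auto
qed

instance padic_int :: (prime_card) ring_char_0
proof
  show "inj (of_nat :: nat \<Rightarrow> 'a padic_int)"
  proof (rule injI)
    fix m n :: nat
    assume eq: "(of_nat m :: 'a padic_int) = of_nat n"
    have less: "k < CARD('a) ^ (m + n)" if "k \<le> m + n" for k
      using that power_gt_expt[of "CARD('a)" "m + n"] prime_gt_1_nat[OF prime_card[where 'a='a]]
      by simp
    from eq have "int m mod int CARD('a) ^ (m + n) = int n mod int CARD('a) ^ (m + n)"
      by (simp flip: Rep_padic_int_of_nat)
    then have "int (m mod CARD('a) ^ (m + n)) = int (n mod CARD('a) ^ (m + n))"
      by (simp only: zmod_int of_nat_power)
    with less[of m] less[of n] show "m = n" by simp
  qed
qed

lemma padic_val_mult: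
  fixes x y :: "'p::prime_card padic_int"
  assumes "x \<noteq> 0" "y \<noteq> 0"
  shows "padic_val (x * y) = padic_val x + padic_val y"
proof -
  have "n \<le> padic_val (x * y) \<longleftrightarrow> n \<le> padic_val x + padic_val y" for n
    using padic_val_mult_aux[OF assms, of n] padic_val_dvd_iff[of "x * y" n] assms by simp
  then show ?thesis by (metis order_antisym order_refl)
qed


section \<open>The field \<open>\<rat>\<^sub>\<ell>\<close> and its algebraic closure\<close>

instance fract :: ("{idom, ring_char_0}") field_char_0
proof
  show "inj (of_nat :: nat \<Rightarrow> 'a fract)"
    by (rule injI) (simp add: of_nat_fract eq_fract)
qed

type_synonym 'p padic = "'p padic_int fract"
type_synonym 'p padic_bar = "'p padic_int fract alg_closure"

definition padic_int_to_bar :: "'p::prime_card padic_int \<Rightarrow> 'p padic_bar" where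
  "padic_int_to_bar x = to_ac (Fract x 1)"

definition padic_int_abs :: "'p::prime_card padic_int \<Rightarrow> real" where
  "padic_int_abs x = (if x = 0 then 0 else 1 / real CARD('p) ^ padic_val x)"

lemma padic_int_abs_mult: "padic_int_abs (x * y) = padic_int_abs x * padic_int_abs y"
  by (simp add: padic_int_abs_def padic_val_mult power_add)

lemma padic_int_abs_eq_0_iff: "padic_int_abs (x :: 'p::prime_card padic_int) = 0 \<longleftrightarrow> x = 0"
  using prime_gt_0_nat[OF prime_card[where 'a='p]] by (simp add: padic_int_abs_def)

definition padic_abs :: "'p::prime_card padic \<Rightarrow> real" where
  "padic_abs q = (THE r. \<exists>a b. b \<noteq> 0 \<and> q = Fract a b \<and> r = padic_int_abs a / padic_int_abs b)"

lemma padic_abs_Fract: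
  assumes "b \<noteq> 0"
  shows "padic_abs (Fract a b) = padic_int_abs a / padic_int_abs b"
  unfolding padic_abs_def
proof (rule the_equality)
  fix r
  assume "\<exists>c d. d \<noteq> 0 \<and> Fract a b = Fract c d \<and> r = padic_int_abs c / padic_int_abs d"
  then obtain c d where cd: "d \<noteq> 0" "Fract a b = Fract c d" "r = padic_int_abs c / padic_int_abs d"
    by blast
  then have "a * d = c * b" using assms by (simp add: eq_fract)
  then have "padic_int_abs a * padic_int_abs d = padic_int_abs c * padic_int_abs b"
    by (simp flip: padic_int_abs_mult)
  then show "r = padic_int_abs a / padic_int_abs b"
    using cd assms by (simp add: frac_eq_eq padic_int_abs_eq_0_iff)
qed (use assms in blast)

definition padic_minpoly :: "'p::prime_card padic_bar \<Rightarrow> 'p padic poly" where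
  "padic_minpoly x = (THE p. Polynomial.lead_coeff p = 1 \<and> Factorial_Ring.irreducible p \<and>
     poly (map_poly to_ac p) x = 0)"

text \<open>The unique extension of the \<open>\<ell>\<close>-adic absolute value to the algebraic closure: the absolute
  value of the norm of \<open>x\<close> from \<open>\<rat>\<^sub>\<ell>(x)\<close> to \<open>\<rat>\<^sub>\<ell>\<close> is that of the constant coefficient of the
  minimal polynomial, and one takes its \<open>d\<close>-th root, \<open>d\<close> being the degree of \<open>x\<close>.\<close>

definition padic_bar_abs :: "'p::prime_card padic_bar \<Rightarrow> real" where
  "padic_bar_abs x = root (Polynomial.degree (padic_minpoly x))
     (padic_abs (Polynomial.coeff (padic_minpoly x) 0))"

lemma poly_map_poly_to_ac: "poly (map_poly to_ac p) (to_ac q) = to_ac (poly p q)"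
  by (induction p) (simp_all add: map_poly_pCons)

lemma padic_minpoly_to_ac: "padic_minpoly (to_ac q) = [:-q, 1:]"
  unfolding padic_minpoly_def
proof (rule the_equality, intro conjI)
  show "Polynomial.lead_coeff [:-q, 1:] = 1" by simp
  show "Factorial_Ring.irreducible [:-q, 1:]"
    by (rule irreducible_linear_field_poly) simp
  show "poly (map_poly to_ac [:-q, 1:]) (to_ac q) = 0"
    by (simp only: poly_map_poly_to_ac) simp
next
  fix p :: "'a padic poly"
  assume p: "Polynomial.lead_coeff p = 1 \<and> Factorial_Ring.irreducible p \<and>
    poly (map_poly to_ac p) (to_ac q) = 0"
  then have "poly p q = 0" by (simp add: poly_map_poly_to_ac)
  then obtain c where c: "p = [:-q, 1:] * c" by (auto simp: poly_eq_0_iff_dvd elim: dvdE)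
  have "\<not> is_unit [:-q, 1:]" by (simp add: is_unit_iff_degree)
  with p c have "is_unit c" by (metis Factorial_Ring.irreducibleD)
  then obtain d where "c = [:d:]" by (metis degree_eq_zeroE is_unit_iff_degree not_is_unit_0)
  moreover have "d = 1"
    using p unfolding c \<open>c = [:d:]\<close> by (simp only: lead_coeff_mult) simp
  ultimately show "p = [:-q, 1:]" using c by simp
qed

lemma padic_bar_abs_to_ac: "padic_bar_abs (to_ac q) = padic_abs q"
proof (cases q)
  case (Fract a b)
  have "padic_val (- a) = padic_val a" by (simp add: padic_val_def)
  then have "padic_int_abs (- a) = padic_int_abs a" by (simp add: padic_int_abs_def)
  then show ?thesis
    using Fract by (simp add: padic_bar_abs_def padic_minpoly_to_ac padic_abs_Fract)
qed

definition cyclotomic_padic_field :: "nat \<Rightarrow> 'p::prime_card padic_bar set" where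
  "cyclotomic_padic_field n =
     generate_field ring_of_type_algebra (range to_ac \<union> {z. z ^ n = 1})"

definition padic_valuation_ring :: "'p::prime_card padic_bar set \<Rightarrow> 'p padic_bar set" where
  "padic_valuation_ring K = {x \<in> K. padic_bar_abs x \<le> 1}"

definition algebraic_embedding :: "(complex \<Rightarrow> 'a::field) \<Rightarrow> bool" where
  "algebraic_embedding \<iota> \<longleftrightarrow> \<iota> 1 = 1 \<and>
     (\<forall>x y. Polynomial.algebraic x \<longrightarrow> Polynomial.algebraic y \<longrightarrow>
        \<iota> (x + y) = \<iota> x + \<iota> y \<and> \<iota> (x * y) = \<iota> x * \<iota> y)"

definition fps_over :: "'a::comm_ring_1 set \<Rightarrow> 'a fps set" where
  "fps_over R = {f. \<forall>n. fps_nth f n \<in> R}"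

definition fps_units_over :: "'a::comm_ring_1 set \<Rightarrow> 'a fps set" where
  "fps_units_over R = {u \<in> fps_over R. \<exists>v \<in> fps_over R. u * v = 1}"

definition fps_to_bar :: "'p::prime_card padic_int fps \<Rightarrow> 'p padic_bar fps" where
  "fps_to_bar f = Abs_fps (\<lambda>n. padic_int_to_bar (fps_nth f n))"


section \<open>Cayley graphs, voltages and the Iwasawa polynomial\<close>

definition cayley_graph :: "('g, 'm) monoid_scheme \<Rightarrow> 'g set \<Rightarrow> ('g, 'g \<times> 'g) pre_digraph" where
  "cayley_graph G S =
     \<lparr> verts = carrier G,
       arcs = {(g, h). g \<in> carrier G \<and> h \<in> carrier G \<and> g \<otimes>\<^bsub>G\<^esub> inv\<^bsub>G\<^esub> h \<in> S},
       tail = fst, head = snd \<rparr>"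

definition cayley_voltage :: "('g, 'm) monoid_scheme \<Rightarrow> ('g \<Rightarrow> 'a) \<Rightarrow> 'g \<times> 'g \<Rightarrow> 'a" where
  "cayley_voltage G \<beta> = (\<lambda>(g, h). \<beta> (g \<otimes>\<^bsub>G\<^esub> inv\<^bsub>G\<^esub> h))"

definition int_binomial_coeff :: "int \<Rightarrow> nat \<Rightarrow> int" where
  "int_binomial_coeff b k = (\<Prod>i=0..<k. b - int i) div fact k"

lemma of_int_int_binomial_coeff:
  "(of_int (int_binomial_coeff b k) :: 'a::field_char_0) = of_int b gchoose k"
proof -
  have "fact k dvd (\<Prod>i=0..<k. b - int i)"
    unfolding gbinomial_int_mult_fact[symmetric] by (rule dvd_triv_left)
  then obtain c where c: "(\<Prod>i=0..<k. b - int i) = fact k * c" by (elim dvdE)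
  have "(of_int b gchoose k :: 'a) = of_int (\<Prod>i=0..<k. b - int i) / fact k"
    unfolding gbinomial_prod_rev of_int_prod by simp
  also have "\<dots> = of_int c" unfolding c by simp
  also have "c = int_binomial_coeff b k" unfolding int_binomial_coeff_def c by simp
  finally show ?thesis ..
qed

definition one_plus_T_powi :: "int \<Rightarrow> 'a::comm_ring_1 fps" where
  "one_plus_T_powi b = Abs_fps (\<lambda>k. of_int (int_binomial_coeff b k))"

text \<open>Only used for elements of the subring \<open>\<int>\<close> of \<open>\<int>\<^sub>\<ell>\<close>.\<close>

definition padic_to_int :: "'p::prime_card padic_int \<Rightarrow> int" where
  "padic_to_int x = (THE b. x = of_int b)"

lemma padic_to_int_of_int [simp]: "padic_to_int (of_int b) = b"
  by (simp add: padic_to_int_def)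

text \<open>For an integer-valued voltage \<open>\<alpha>\<close> on the directed edges of a graph and an enumeration \<open>v\<close> of its
  vertices this is the determinant of the degree matrix minus the adjacency matrix in which an
  edge \<open>e\<close> is counted with weight \<open>(1 + T)\<^bsup>\<alpha>(e)\<^esup>\<close>.\<close>

definition iwasawa_poly ::
  "('v, 'e) pre_digraph \<Rightarrow> ('e \<Rightarrow> 'p::prime_card padic_int) \<Rightarrow> (nat \<Rightarrow> 'v) \<Rightarrow> 'p padic_int fps" where
  "iwasawa_poly \<Gamma> \<alpha> v = Determinant.det (mat (card (verts \<Gamma>)) (card (verts \<Gamma>)) (\<lambda>(i, j).
     (if i = j then of_nat (out_degree \<Gamma> (v i)) else 0) -
     (\<Sum>e | e \<in> arcs \<Gamma> \<and> tail \<Gamma> e = v i \<and> head \<Gamma> e = v j. one_plus_T_powi (padic_to_int (\<alpha> e)))))"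

lemma out_degree_cayley_graph:
  assumes "comm_group G" "S \<subseteq> carrier G" "m_inv G ` S = S" "g \<in> carrier G"
  shows "out_degree (cayley_graph G S) g = card S"
proof -
  interpret comm_group G by fact
  have "bij_betw (\<lambda>s. (g, inv\<^bsub>G\<^esub> s \<otimes>\<^bsub>G\<^esub> g)) S (out_arcs (cayley_graph G S) g)"
  proof (rule bij_betwI[where g = "\<lambda>(a, h). a \<otimes>\<^bsub>G\<^esub> inv\<^bsub>G\<^esub> h"])
    show "(\<lambda>s. (g, inv\<^bsub>G\<^esub> s \<otimes>\<^bsub>G\<^esub> g)) \<in> S \<rightarrow> out_arcs (cayley_graph G S) g"
    proof
      fix s assume s: "s \<in> S"
      then have "s \<in> carrier G" using assms(2) by auto
      then have "g \<otimes>\<^bsub>G\<^esub> inv\<^bsub>G\<^esub> (inv\<^bsub>G\<^esub> s \<otimes>\<^bsub>G\<^esub> g) = s"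
        using assms(4) by (simp add: inv_mult m_lcomm[of g s])
      with s \<open>s \<in> carrier G\<close> show "(g, inv\<^bsub>G\<^esub> s \<otimes>\<^bsub>G\<^esub> g) \<in> out_arcs (cayley_graph G S) g"
        using assms(4) by (simp add: out_arcs_def cayley_graph_def)
    qed
    show "(\<lambda>(a, h). a \<otimes>\<^bsub>G\<^esub> inv\<^bsub>G\<^esub> h) \<in> out_arcs (cayley_graph G S) g \<rightarrow> S"
      by (auto simp: out_arcs_def cayley_graph_def)
  next
    fix s assume "s \<in> S"
    then have "s \<in> carrier G" using assms(2) by auto
    then show "(case (g, inv\<^bsub>G\<^esub> s \<otimes>\<^bsub>G\<^esub> g) of (a, h) \<Rightarrow> a \<otimes>\<^bsub>G\<^esub> inv\<^bsub>G\<^esub> h) = s"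
      using assms(4) by (simp add: inv_mult m_lcomm[of g s])
  next
    fix e assume "e \<in> out_arcs (cayley_graph G S) g"
    then obtain h where h: "e = (g, h)" "h \<in> carrier G"
      by (auto simp: out_arcs_def cayley_graph_def)
    then have "inv\<^bsub>G\<^esub> (g \<otimes>\<^bsub>G\<^esub> inv\<^bsub>G\<^esub> h) \<otimes>\<^bsub>G\<^esub> g = h"
      using assms(4) by (simp add: inv_mult m_comm[of "inv\<^bsub>G\<^esub> g" h] m_assoc)
    with h show "(g, inv\<^bsub>G\<^esub> (case e of (a, h) \<Rightarrow> a \<otimes>\<^bsub>G\<^esub> inv\<^bsub>G\<^esub> h) \<otimes>\<^bsub>G\<^esub> g) = e" by simp
  qed
  then show ?thesis unfolding out_degree_def by (rule bij_betw_same_card[symmetric])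
qed

lemma iwasawa_poly_cayley:
  assumes "comm_group G" "S \<subseteq> carrier G" "m_inv G ` S = S"
    and "bij_betw g {..<card (carrier G)} (carrier G)"
  shows "iwasawa_poly (cayley_graph G S) (cayley_voltage G \<beta>) g =
    Determinant.det (mat (card (carrier G)) (card (carrier G)) (\<lambda>(i, j).
      of_nat (card S) * (if i = j then 1 else 0) -
      (if g i \<otimes>\<^bsub>G\<^esub> inv\<^bsub>G\<^esub> g j \<in> S then 1 else 0) *
        one_plus_T_powi (padic_to_int (\<beta> (g i \<otimes>\<^bsub>G\<^esub> inv\<^bsub>G\<^esub> g j)))))"
proof -
  have arcs: "{e. e \<in> arcs (cayley_graph G S) \<and> tail (cayley_graph G S) e = g i \<and>
      head (cayley_graph G S) e = g j} = (if g i \<otimes>\<^bsub>G\<^esub> inv\<^bsub>G\<^esub> g j \<in> S then {(g i, g j)} else {})"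
    if "i < card (carrier G)" "j < card (carrier G)" for i j
  proof -
    have "g i \<in> carrier G" "g j \<in> carrier G" using that assms(4) by (auto dest: bij_betwE)
    then show ?thesis by (auto simp: cayley_graph_def)
  qed
  have deg: "out_degree (cayley_graph G S) (g i) = card S" if "i < card (carrier G)" for i
    using that assms(4) by (intro out_degree_cayley_graph[OF assms(1-3)]) (auto dest: bij_betwE)
  have card: "card (verts (cayley_graph G S)) = card (carrier G)"
    by (simp add: cayley_graph_def)
  show ?thesis
    unfolding iwasawa_poly_def card
    by (intro arg_cong[where f = Determinant.det] cong_mat refl)
      (simp add: arcs deg cayley_voltage_def)
qed


section \<open>Characters\<close>

definition complex_units :: "complex monoid" where
  "complex_units = \<lparr> carrier = - {0}, monoid.mult = (*), one = 1 \<rparr>"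

text \<open>Extensionality makes equality of characters mean equality on \<open>carrier G\<close>.\<close>

definition characters :: "('g, 'm) monoid_scheme \<Rightarrow> ('g \<Rightarrow> complex) set" where
  "characters G = hom G complex_units \<inter> extensional (carrier G)"

definition beta_max :: "'g set \<Rightarrow> ('g \<Rightarrow> 'p::prime_card padic_int) \<Rightarrow> int" where
  "beta_max S \<beta> = Max ((\<lambda>s. padic_to_int (\<beta> s)) ` S)"

text \<open>The exponents are nonnegative: \<open>beta_max S \<beta> \<ge> 0\<close> because \<open>\<beta>(s\<^sup>-\<^sup>1) = -\<beta>(s)\<close>.\<close>

definition character_poly ::
  "(complex \<Rightarrow> 'p padic_bar) \<Rightarrow> 'g set \<Rightarrow> ('g \<Rightarrow> 'p::prime_card padic_int) \<Rightarrow> ('g \<Rightarrow> complex)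
     \<Rightarrow> 'p padic_bar poly" where
  "character_poly \<iota> S \<beta> \<psi> =
     of_nat (card S) * [:1, 1:] ^ nat (beta_max S \<beta>) -
     (\<Sum>s\<in>S. Polynomial.smult (\<iota> (\<psi> s)) ([:1, 1:] ^ nat (beta_max S \<beta> - padic_to_int (\<beta> s))))"

end

theory Submission
  imports Defs
begin

text \<open>The matrix with entries \<open>F (g\<^sub>i g\<^sub>j\<^sup>-\<^sup>1)\<close> has every character \<open>\<psi>\<close> of the group as an eigenvector, with
  eigenvalue \<open>\<Sum>\<^sub>x \<psi>(x\<^sup>-\<^sup>1) F(x)\<close>. By orthogonality the character table is invertible, so the determinant
  is the product of these eigenvalues (Dedekind). For the matrix defining the Iwasawa polynomial the
  substitution \<open>s \<mapsto> s\<^sup>-\<^sup>1\<close> turns the eigenvalue of \<open>\<psi>\<close> into \<open>(1 + T)\<close> to the power \<open>- m\<^sub>\<beta>\<close> times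
  \<open>P\<^sub>\<psi>\<close>; the unit is therefore \<open>1 + T\<close> to the power \<open>- |G| m\<^sub>\<beta>\<close>, which even has integer coefficients.\<close>

section \<open>Characters of finite abelian groups\<close>

lemma (in group) nat_pow_mem_imp_Least_dvd:
  assumes H: "subgroup H G" and y: "y \<in> carrier G"
    and k: "k > 0" "y [^] k \<in> H" "\<And>j::nat. 0 < j \<Longrightarrow> j < k \<Longrightarrow> y [^] j \<notin> H"
    and d: "y [^] (d::nat) \<in> H"
  shows "k dvd d"
proof -
  have pow: "z [^] (q::nat) \<in> H" if "z \<in> H" for z q
    using H that by (induction q) (auto intro: subgroup.one_closed subgroup.m_closed)
  let ?a = "(y [^] k) [^] (d div k)"
  have a: "?a \<in> H" using k(2) by (rule pow)
  have ac: "?a \<in> carrier G" using y by simp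
  \<comment> \<open>Division with remainder: the power of \<open>y\<close> with exponent
    \<open>d mod k\<close> also lies in \<open>H\<close>, so minimality of \<open>k\<close> forces
    this exponent to be 0.\<close>
  have "y [^] d = y [^] (k * (d div k) + d mod k)" by simp
  also have "\<dots> = ?a \<otimes> y [^] (d mod k)"
    using y by (simp only: nat_pow_mult[symmetric] nat_pow_pow[symmetric])
  finally have "y [^] (d mod k) = inv ?a \<otimes> y [^] d"
    using y ac by (metis inv_solve_left nat_pow_closed)
  then have "y [^] (d mod k) \<in> H"
    using H a d by (simp add: subgroup.m_closed subgroup.m_inv_closed)
  then have "d mod k = 0" using k(1) k(3)[of "d mod k"] by (cases "d mod k = 0") auto
  then show ?thesis by auto
qed

text \<open>This adjoins one element \<open>y\<close>. As \<open>k\<close> is the order of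
  \<open>y\<close> modulo \<open>H\<close>, the only constraint on the new value \<open>c\<close> is
  \<open>c ^ k = \<chi> (y [^] k)\<close>; then \<open>h y^i\<close> can be sent to
  \<open>\<chi> h * c ^ i\<close>.\<close>

lemma (in comm_group) extend_multiplicative:
  fixes \<chi> :: "'a \<Rightarrow> 'f::field"
  assumes H: "subgroup H G" and y: "y \<in> carrier G"
    and \<chi>1: "\<chi> \<one> = 1" and \<chi>m: "\<And>a b. a \<in> H \<Longrightarrow> b \<in> H \<Longrightarrow> \<chi> (a \<otimes> b) = \<chi> a * \<chi> b"
    and k: "k > 0" "y [^] k \<in> H" "\<And>j::nat. 0 < j \<Longrightarrow> j < k \<Longrightarrow> y [^] j \<notin> H"
    and c: "c ^ k = \<chi> (y [^] k)"
  obtains H' \<chi>' where "subgroup H' G" "H \<subseteq> H'" "y \<in> H'"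
    "\<And>a. a \<in> H \<Longrightarrow> \<chi>' a = \<chi> a" "\<chi>' y = c"
    "\<And>a b. a \<in> H' \<Longrightarrow> b \<in> H' \<Longrightarrow> \<chi>' (a \<otimes> b) = \<chi>' a * \<chi>' b"
proof -
  have Hc: "h \<in> H \<Longrightarrow> h \<in> carrier G" for h using H by (rule subgroup.mem_carrier)
  have pow: "z [^] (q::nat) \<in> H \<and> \<chi> (z [^] q) = \<chi> z ^ q" if "z \<in> H" for z q
    using H that \<chi>1 \<chi>m
    by (induction q) (auto intro: subgroup.one_closed subgroup.m_closed)
  \<comment> \<open>Cancelling \<open>y^i\<close> leaves \<open>y^d\<close> in \<open>H\<close> with
    \<open>d = j - i\<close>. Then \<open>k\<close> divides \<open>d\<close>, and the condition on
    \<open>c\<close> gives \<open>\<chi> (y^d) = c ^ d\<close>.\<close>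
  have wd0: "\<chi> h * c ^ i = \<chi> h' * c ^ j"
    if h: "h \<in> H" "h' \<in> H" and eq: "h \<otimes> y [^] i = h' \<otimes> y [^] j" and ij: "i \<le> j"
    for h h' and i j :: nat
  proof -
    obtain d where d: "j = i + d" using ij by (metis le_add_diff_inverse)
    have "h \<otimes> y [^] i = (h' \<otimes> y [^] d) \<otimes> y [^] i"
      using eq y Hc[OF h(2)] by (simp add: d m_assoc nat_pow_mult add.commute)
    then have hd: "h = h' \<otimes> y [^] d" using y Hc[OF h(1)] Hc[OF h(2)] by simp
    then have yd: "y [^] d = inv h' \<otimes> h"
      using y Hc[OF h(1)] Hc[OF h(2)] by (metis inv_solve_left nat_pow_closed)
    then have ydH: "y [^] d \<in> H" using H h by (simp add: subgroup.m_closed subgroup.m_inv_closed)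
    then have "k dvd d" using nat_pow_mem_imp_Least_dvd[OF H y k] by blast
    then obtain q where q: "d = k * q" by (elim dvdE)
    have "\<chi> (y [^] d) = \<chi> ((y [^] k) [^] q)" using y by (simp add: q nat_pow_pow)
    also have "\<dots> = c ^ d" using pow[OF k(2), of q] c by (simp add: q power_mult)
    finally have "\<chi> h = \<chi> h' * c ^ d" using hd \<chi>m[OF h(2) ydH] by simp
    then show ?thesis by (simp add: d power_add mult_ac)
  qed
  have wd: "\<chi> h * c ^ i = \<chi> h' * c ^ j"
    if "h \<in> H" "h' \<in> H" "h \<otimes> y [^] i = h' \<otimes> y [^] j" for h h' and i j :: nat
    using wd0[of h h' i j] wd0[of h' h j i] that by (metis nat_le_linear)
  \<comment> \<open>Natural exponents suffice for a subgroup: since \<open>y^k\<close> lies in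
    \<open>H\<close>, the inverse of \<open>y\<close> is \<open>y^(k-1)\<close> times an element of
    \<open>H\<close>.\<close>
  define H' where "H' = {h \<otimes> y [^] i | h i::nat. h \<in> H}"
  \<comment> \<open>The decomposition \<open>h y^i\<close> is not unique; \<open>wd\<close> makes
    the value independent of it.\<close>
  define \<chi>' where "\<chi>' z = (THE w. \<exists>h (i::nat). h \<in> H \<and> z = h \<otimes> y [^] i \<and> w = \<chi> h * c ^ i)" for z
  have \<chi>': "\<chi>' (h \<otimes> y [^] i) = \<chi> h * c ^ i" if "h \<in> H" for h and i :: nat
    unfolding \<chi>'_def by (rule the_equality) (use that in blast, metis that wd)
  have prod: "(h \<otimes> y [^] i) \<otimes> (h' \<otimes> y [^] j) = (h \<otimes> h') \<otimes> y [^] (i + j)"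
    if "h \<in> H" "h' \<in> H" for h h' and i j :: nat
    using Hc[OF that(1)] Hc[OF that(2)] y by (simp add: m_ac flip: nat_pow_mult)
  have one: "\<one> \<in> H" using H by (rule subgroup.one_closed)
  have sub: "H \<subseteq> H'"
  proof
    fix h assume h: "h \<in> H"
    then have "h = h \<otimes> y [^] (0::nat)" using Hc by simp
    then show "h \<in> H'" unfolding H'_def using h by blast
  qed
  have "subgroup H' G"
  proof (rule subgroupI)
    show "H' \<subseteq> carrier G" using Hc y unfolding H'_def by auto
    show "H' \<noteq> {}" using sub one by auto
    show "a \<otimes> b \<in> H'" if ab: "a \<in> H'" "b \<in> H'" for a b
    proof -
      obtain h i h' j where *: "h \<in> H" "h' \<in> H" "a = h \<otimes> y [^] (i::nat)" "b = h' \<otimes> y [^] (j::nat)"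
        using ab unfolding H'_def by blast
      then show ?thesis
        unfolding H'_def using H prod[of h h' i j] by (auto intro: subgroup.m_closed)
    qed
    show "inv a \<in> H'" if a: "a \<in> H'" for a
    proof -
      obtain h i where *: "h \<in> H" "a = h \<otimes> y [^] (i::nat)"
        using a unfolding H'_def by blast
      obtain k' where k': "k = Suc k'" using k(1) by (cases k) auto
      \<comment> \<open>The inverse of \<open>h y^i\<close> with a natural exponent:
        \<open>y^(-i) = (y^k)^(-i) y^((k-1)i)\<close>, and \<open>?b\<close> collects the factors
        from \<open>H\<close>.\<close>
      let ?b = "inv h \<otimes> inv ((y [^] k) [^] i)"
      have b: "?b \<in> H"
        using H *(1) pow[OF k(2), of i] by (simp add: subgroup.m_closed subgroup.m_inv_closed)
      have "k * i = k' * i + i" by (simp add: k')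
      then have yk: "(y [^] k) [^] i = y [^] (k' * i) \<otimes> y [^] i"
        using y by (simp only: nat_pow_pow nat_pow_mult)
      have "(?b \<otimes> y [^] (k' * i)) \<otimes> a = \<one>"
        unfolding yk *(2) using y Hc[OF *(1)] by (simp add: inv_mult m_ac)
      then have "inv a = ?b \<otimes> y [^] (k' * i)"
        using y Hc[OF *(1)] Hc[OF b] *(2) by (intro inv_equality) auto
      with b show ?thesis unfolding H'_def by blast
    qed
  qed
  show thesis
  proof (rule that)
    show "subgroup H' G" by fact
    show "H \<subseteq> H'" by fact
    show "y \<in> H'" unfolding H'_def using one y by (auto intro!: exI[of _ \<one>] exI[of _ "1::nat"])
    show "\<chi>' a = \<chi> a" if "a \<in> H" for a using \<chi>'[OF that, of 0] Hc[OF that] by simp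
    show "\<chi>' y = c" using \<chi>'[OF one, of 1] y \<chi>1 by simp
    show "\<chi>' (a \<otimes> b) = \<chi>' a * \<chi>' b" if ab: "a \<in> H'" "b \<in> H'" for a b
    proof -
      obtain h i h' j where *: "h \<in> H" "h' \<in> H" "a = h \<otimes> y [^] (i::nat)" "b = h' \<otimes> y [^] (j::nat)"
        using ab unfolding H'_def by blast
      then show ?thesis
        using H by (simp add: prod \<chi>' \<chi>m subgroup.m_closed power_add mult_ac)
    qed
  qed
qed


lemma mem_characters_iff:
  "\<psi> \<in> characters G \<longleftrightarrow> \<psi> \<in> extensional (carrier G) \<and> (\<forall>x\<in>carrier G. \<psi> x \<noteq> 0) \<and>
     (\<forall>x\<in>carrier G. \<forall>y\<in>carrier G. \<psi> (x \<otimes>\<^bsub>G\<^esub> y) = \<psi> x * \<psi> y)"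
  by (auto simp: characters_def hom_def complex_units_def)

text \<open>Elements outside \<open>H\<close> are adjoined one after another, by induction on the
  number of elements still missing. A value for each exists because every complex number has a
  \<open>k\<close>-th root.\<close>

lemma (in comm_group) extend_to_character:
  fixes \<chi> :: "'a \<Rightarrow> complex"
  assumes fin: "finite (carrier G)" and "subgroup H G" "\<chi> \<one> = 1"
    and "\<And>a b. a \<in> H \<Longrightarrow> b \<in> H \<Longrightarrow> \<chi> (a \<otimes> b) = \<chi> a * \<chi> b"
  shows "\<exists>\<psi>\<in>characters G. \<forall>a\<in>H. \<psi> a = \<chi> a"
  using assms(2-)
proof (induction "card (carrier G) - card H" arbitrary: H \<chi> rule: less_induct)
  case less
  note H = less.prems(1)
  have Hsub: "H \<subseteq> carrier G" using H by (rule subgroup.subset)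
  show ?case
  proof (cases "H = carrier G")
    case True
    have "\<chi> a \<noteq> 0" if "a \<in> carrier G" for a
      using less.prems(2) less.prems(3)[of a "inv a"] that True by auto
    then have "restrict \<chi> (carrier G) \<in> characters G"
      using less.prems(3) True by (simp add: mem_characters_iff)
    then show ?thesis using True by (intro bexI[of _ "restrict \<chi> (carrier G)"]) auto
  next
    case False
    then obtain y where y: "y \<in> carrier G" "y \<notin> H" using Hsub by auto
    \<comment> \<open>Such exponents exist: the group order is one.\<close>
    define k where "k = (LEAST k::nat. 0 < k \<and> y [^] k \<in> H)"
    have "y [^] Coset.order G = \<one>" using y(1) by (rule pow_order_eq_1)
    then have "0 < Coset.order G \<and> y [^] Coset.order G \<in> H"
      using fin H by (simp add: order_gt_0_iff_finite subgroup.one_closed)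
    then have k: "0 < k \<and> y [^] k \<in> H" unfolding k_def by (rule LeastI)
    have kmin: "y [^] j \<notin> H" if "0 < j" "j < k" for j :: nat
      using that not_less_Least[of j "\<lambda>k. 0 < k \<and> y [^] k \<in> H"] unfolding k_def by auto
    let ?z = "\<chi> (y [^] k)"
    \<comment> \<open>A \<open>k\<close>-th root of \<open>?z\<close> in polar form.\<close>
    define c where "c = rcis (root k (cmod ?z)) (Arg ?z / real k)"
    have c: "c ^ k = ?z" using k by (simp add: c_def DeMoivre2 rcis_cmod_Arg)
    obtain H' \<chi>' where *: "subgroup H' G" "H \<subseteq> H'" "y \<in> H'" "\<And>a. a \<in> H \<Longrightarrow> \<chi>' a = \<chi> a"
        "\<chi>' y = c" "\<And>a b. a \<in> H' \<Longrightarrow> b \<in> H' \<Longrightarrow> \<chi>' (a \<otimes> b) = \<chi>' a * \<chi>' b"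
      by (rule extend_multiplicative[OF H y(1) less.prems(2,3) conjunct1[OF k] conjunct2[OF k] kmin c]) blast+
    have "finite H'" using fin *(1) by (meson finite_subset subgroup.subset)
    moreover have "H \<subset> H'" using *(2,3) y(2) by auto
    ultimately have "card H < card H'" by (rule psubset_card_mono)
    moreover have "card H' \<le> card (carrier G)" using fin *(1) by (meson card_mono subgroup.subset)
    ultimately have "card (carrier G) - card H' < card (carrier G) - card H" by simp
    moreover have "\<chi>' \<one> = 1" using *(4) less.prems(2) H by (simp add: subgroup.one_closed)
    ultimately obtain \<psi> where "\<psi> \<in> characters G" "\<forall>a\<in>H'. \<psi> a = \<chi>' a"
      using less.hyps[of H' \<chi>'] *(1,6) by blast
    then show ?thesis using *(2,4) by (intro bexI[of _ \<psi>]) auto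
  qed
qed

text \<open>Over the trivial subgroup \<open>k\<close> is the order of \<open>x\<close>, which
  exceeds 1. Hence some \<open>k\<close>-th root of unity other than 1 is admissible as value at
  \<open>x\<close>, and the resulting function extends to the whole group.\<close>

lemma (in comm_group) exists_character_neq_1:
  assumes fin: "finite (carrier G)" and x: "x \<in> carrier G" "x \<noteq> \<one>"
  shows "\<exists>\<psi>\<in>characters G. \<psi> x \<noteq> 1"
proof -
  define k where "k = (LEAST k::nat. 0 < k \<and> x [^] k \<in> {\<one>})"
  have "0 < Coset.order G \<and> x [^] Coset.order G \<in> {\<one>}"
    using fin x by (simp add: order_gt_0_iff_finite pow_order_eq_1)
  then have k: "0 < k \<and> x [^] k \<in> {\<one>}" unfolding k_def by (rule LeastI)
  have kmin: "x [^] j \<notin> {\<one>}" if "0 < j" "j < k" for j :: nat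
    using that not_less_Least[of j "\<lambda>k. 0 < k \<and> x [^] k \<in> {\<one>}"] unfolding k_def by auto
  have "k \<noteq> 1" using k x by auto
  have "\<exists>c::complex. c ^ k = 1 \<and> c \<noteq> 1"
  proof (rule ccontr)
    assume "\<not> ?thesis"
    then have "{z::complex. z ^ k = 1} \<subseteq> {1}" by auto
    then have "card {z::complex. z ^ k = 1} \<le> 1" using card_mono[of "{1::complex}"] by fastforce
    then show False using k \<open>k \<noteq> 1\<close> by (simp add: card_roots_unity_eq)
  qed
  then obtain c :: complex where c: "c ^ k = 1" "c \<noteq> 1" by blast
  have triv: "subgroup {\<one>} G" by (rule triv_subgroup)
  obtain H \<chi> where *: "subgroup H G" "{\<one>} \<subseteq> H" "x \<in> H" "\<chi> \<one> = 1" "\<chi> x = c"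
      "\<And>a b. a \<in> H \<Longrightarrow> b \<in> H \<Longrightarrow> \<chi> (a \<otimes> b) = \<chi> a * \<chi> b"
    using extend_multiplicative[OF triv x(1), of "\<lambda>_. 1" k c] k kmin c by auto
  obtain \<psi> where "\<psi> \<in> characters G" "\<forall>a\<in>H. \<psi> a = \<chi> a"
    using extend_to_character[OF fin *(1,4,6)] by blast
  then show ?thesis using *(3,5) c(2) by (intro bexI[of _ \<psi>]) auto
qed

section \<open>Roots of unity under an embedding of the algebraic numbers\<close>

lemma algebraic_root_of_unity_diff:
  fixes z :: "'a::field_char_0"
  assumes "z ^ n = 1" "n > 0"
  shows "Polynomial.algebraic (z - of_int a)"
proof (rule algebraicI)
  let ?P = "[:a, 1:] ^ n - 1 :: int poly"
  let ?p = "of_int_poly ?P :: 'a poly"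
  show "Polynomial.coeff ?p i \<in> \<int>" for i by (simp add: coeff_map_poly)
  have p: "?p = [:of_int a, 1:] ^ n - 1"
    by (simp add: of_int_poly_hom.hom_minus of_int_poly_hom.hom_power)
  show "poly ?p (z - of_int a) = 0" using assms by (simp add: p)
  \<comment> \<open>One nonzero value shows that the annihilating polynomial
    \<open>(X + a)^n - 1\<close> is not zero.\<close>
  have "poly ?p (2 - of_int a) = of_int (2 ^ n - 1)" by (simp add: p)
  moreover have "(2::int) ^ n \<noteq> 1" using assms(2) by simp
  ultimately show "?p \<noteq> 0" by (metis eq_iff_diff_eq_0 of_int_eq_0_iff poly_0)
qed

text \<open>This is the instance of injectivity needed for orthogonality. \<open>\<iota>\<close>
  respects the ring operations only on algebraic numbers; a nonzero \<open>z - 1\<close> is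
  algebraic with algebraic inverse, so its image cannot be 0.\<close>

lemma algebraic_embedding_root_of_unity_eq_1:
  assumes \<iota>: "algebraic_embedding \<iota>" and z: "z ^ n = 1" "n > 0" and "\<iota> z = 1"
  shows "z = 1"
proof (rule ccontr)
  assume "z \<noteq> 1"
  have alg: "Polynomial.algebraic (z - 1)" using algebraic_root_of_unity_diff[OF z, of 1] by simp
  have "\<iota> (1 + (z - 1)) = \<iota> 1 + \<iota> (z - 1)"
    using \<iota> alg unfolding algebraic_embedding_def by blast
  then have "\<iota> (z - 1) = 0" using \<iota> \<open>\<iota> z = 1\<close> by (simp add: algebraic_embedding_def)
  moreover have "\<iota> ((z - 1) * inverse (z - 1)) = \<iota> (z - 1) * \<iota> (inverse (z - 1))"
    using \<iota> alg unfolding algebraic_embedding_def by (meson algebraic_inverse)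
  ultimately show False using \<iota> \<open>z \<noteq> 1\<close> by (simp add: algebraic_embedding_def)
qed

section \<open>Orthogonality, the number of characters and the group determinant\<close>

context comm_group
begin

lemma character_one:
  assumes "\<psi> \<in> characters G"
  shows "\<psi> \<one> = 1"
proof -
  have "\<psi> (\<one> \<otimes> \<one>) = \<psi> \<one> * \<psi> \<one>" "\<psi> \<one> \<noteq> 0"
    using assms unfolding mem_characters_iff by blast+
  then show ?thesis by simp
qed

lemma character_root_of_unity:
  assumes "\<psi> \<in> characters G" "x \<in> carrier G"
  shows "\<psi> x ^ Coset.order G = 1"
proof -
  have "\<psi> (x [^] n) = \<psi> x ^ n" for n :: nat
    using assms by (induction n) (auto simp: character_one mem_characters_iff mult.commute)
  then show ?thesis using assms by (metis pow_order_eq_1 character_one)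
qed

text \<open>Extensionality places the characters among the finitely many functions from the carrier
  to the roots of unity of order dividing the group order.\<close>

lemma finite_characters:
  assumes "finite (carrier G)"
  shows "finite (characters G)"
proof (rule finite_subset)
  have pos: "Coset.order G > 0" using assms by (simp add: order_gt_0_iff_finite)
  show "characters G \<subseteq> carrier G \<rightarrow>\<^sub>E {z. z ^ Coset.order G = 1}"
  proof
    fix \<psi> assume \<psi>: "\<psi> \<in> characters G"
    then have "\<psi> \<in> extensional (carrier G)" by (simp add: mem_characters_iff)
    then show "\<psi> \<in> carrier G \<rightarrow>\<^sub>E {z. z ^ Coset.order G = 1}"
      using character_root_of_unity[OF \<psi>] by (simp add: PiE_iff)
  qed
  show "finite (carrier G \<rightarrow>\<^sub>E {z::complex. z ^ Coset.order G = 1})"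
    using assms pos by (intro finite_PiE finite_roots_unity) auto
qed

lemma embedded_character_mult:
  assumes "algebraic_embedding \<iota>" "finite (carrier G)"
    and "\<psi> \<in> characters G" "\<phi> \<in> characters G" "x \<in> carrier G" "y \<in> carrier G"
  shows "\<iota> (\<psi> x * \<phi> y) = \<iota> (\<psi> x) * \<iota> (\<phi> y)"
proof -
  have pos: "Coset.order G > 0" using assms by (simp add: order_gt_0_iff_finite)
  have "Polynomial.algebraic (\<psi> x)" "Polynomial.algebraic (\<phi> y)"
    using algebraic_root_of_unity_diff[OF character_root_of_unity pos, where a = 0] assms by auto
  then show ?thesis using assms(1) by (simp add: algebraic_embedding_def)
qed

text \<open>For \<open>x\<close> other than the identity, multiplication by a character
  \<open>\<phi>\<close> with \<open>\<phi> x\<close> not 1 permutes the characters. So the sum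
  equals itself times \<open>\<iota> (\<phi> x)\<close>, a factor that is still not 1, and
  vanishes.\<close>

lemma sum_characters:
  assumes \<iota>: "algebraic_embedding \<iota>" and fin: "finite (carrier G)" and x: "x \<in> carrier G"
  shows "(\<Sum>\<psi>\<in>characters G. \<iota> (\<psi> x)) = (if x = \<one> then of_nat (card (characters G)) else 0)"
proof (cases "x = \<one>")
  case True
  then show ?thesis using \<iota> by (simp add: character_one algebraic_embedding_def)
next
  case False
  then obtain \<phi> where \<phi>: "\<phi> \<in> characters G" "\<phi> x \<noteq> 1"
    using exists_character_neq_1[OF fin x] by blast
  have "bij_betw (\<lambda>\<psi>. restrict (\<lambda>y. \<phi> y * \<psi> y) (carrier G)) (characters G) (characters G)"
  proof (rule bij_betwI[where g = "\<lambda>\<psi>. restrict (\<lambda>y. inverse (\<phi> y) * \<psi> y) (carrier G)"])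
  qed (use \<phi> in \<open>auto simp: mem_characters_iff extensional_def fun_eq_iff\<close>)
  then have "(\<Sum>\<psi>\<in>characters G. \<iota> (\<psi> x)) =
      (\<Sum>\<psi>\<in>characters G. \<iota> (restrict (\<lambda>y. \<phi> y * \<psi> y) (carrier G) x))"
    by (rule sum.reindex_bij_betw[symmetric])
  also have "\<dots> = \<iota> (\<phi> x) * (\<Sum>\<psi>\<in>characters G. \<iota> (\<psi> x))"
    unfolding sum_distrib_left
    by (rule sum.cong) (simp_all add: x embedded_character_mult[OF \<iota> fin \<phi>(1) _ x x])
  finally have "(\<iota> (\<phi> x) - 1) * (\<Sum>\<psi>\<in>characters G. \<iota> (\<psi> x)) = 0" by (simp add: algebra_simps)
  moreover have "\<iota> (\<phi> x) \<noteq> 1"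
    using algebraic_embedding_root_of_unity_eq_1[OF \<iota> character_root_of_unity[OF \<phi>(1) x]] \<phi>(2)
      fin by (auto simp: order_gt_0_iff_finite)
  ultimately show ?thesis using False by simp
qed

text \<open>The dual relation: for a nontrivial \<open>\<psi>\<close>, translation by some
  \<open>a\<close> with \<open>\<psi> a\<close> not 1 permutes the carrier.\<close>

lemma sum_character:
  assumes \<psi>: "\<psi> \<in> characters G"
  shows "(\<Sum>x\<in>carrier G. \<psi> x) =
    (if \<psi> = restrict (\<lambda>_. 1) (carrier G) then of_nat (card (carrier G)) else 0)"
proof (cases "\<psi> = restrict (\<lambda>_. 1) (carrier G)")
  case True
  then show ?thesis by simp
next
  case False
  have "\<psi> \<in> extensional (carrier G)" using \<psi> by (simp add: mem_characters_iff)
  then obtain a where a: "a \<in> carrier G" "\<psi> a \<noteq> 1"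
    using False by (metis extensionalityI restrict_apply restrict_extensional)
  have "bij_betw (\<lambda>x. a \<otimes> x) (carrier G) (carrier G)"
    by (rule bij_betwI[where g = "\<lambda>x. inv a \<otimes> x"]) (use a in \<open>auto simp flip: m_assoc\<close>)
  then have "(\<Sum>x\<in>carrier G. \<psi> x) = (\<Sum>x\<in>carrier G. \<psi> (a \<otimes> x))"
    by (rule sum.reindex_bij_betw[symmetric])
  also have "\<dots> = \<psi> a * (\<Sum>x\<in>carrier G. \<psi> x)"
    unfolding sum_distrib_left by (rule sum.cong) (use a \<psi> in \<open>auto simp: mem_characters_iff\<close>)
  finally have "(\<psi> a - 1) * (\<Sum>x\<in>carrier G. \<psi> x) = 0" by (simp add: algebra_simps)
  then show ?thesis using a(2) False by simp
qed

text \<open>Double counting of all values \<open>\<psi> x\<close>: summing over characters first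
  leaves only the identity element, summing over elements first leaves only the trivial
  character.\<close>

lemma card_characters:
  assumes fin: "finite (carrier G)"
  shows "card (characters G) = card (carrier G)"
proof -
  have triv: "restrict (\<lambda>_. 1) (carrier G) \<in> characters G" by (simp add: mem_characters_iff)
  \<comment> \<open>The identity embedding makes \<open>sum_characters\<close> available over the
    complex numbers.\<close>
  have id: "algebraic_embedding (\<lambda>z::complex. z)" by (simp add: algebraic_embedding_def)
  have "complex_of_nat (card (characters G)) = (\<Sum>x\<in>carrier G. \<Sum>\<psi>\<in>characters G. \<psi> x)"
    using fin by (simp add: sum_characters[OF id fin])
  also have "\<dots> = (\<Sum>\<psi>\<in>characters G. \<Sum>x\<in>carrier G. \<psi> x)" by (rule sum.swap)
  also have "\<dots> = of_nat (card (carrier G))"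
    using triv by (simp add: sum_character finite_characters[OF fin])
  finally show ?thesis by (simp only: of_nat_eq_iff)
qed

text \<open>The columns of the character table \<open>V\<close> are the eigenvectors, and
  \<open>card_characters\<close> makes \<open>V\<close> square. Power series over a field form an
  integral domain, so \<open>A * V = V * D\<close> and a nonzero \<open>det V\<close> give
  \<open>det A = det D\<close> by cancellation, without inverting \<open>V\<close>.\<close>

theorem group_determinant:
  fixes F :: "'a \<Rightarrow> 'f::field_char_0 fps"
  assumes \<iota>: "algebraic_embedding \<iota>" and fin: "finite (carrier G)"
    and g: "bij_betw g {..<card (carrier G)} (carrier G)"
  shows "Determinant.det (mat (card (carrier G)) (card (carrier G)) (\<lambda>(i, j). F (g i \<otimes> inv g j))) =
    (\<Prod>\<psi>\<in>characters G. \<Sum>x\<in>carrier G. fps_const (\<iota> (\<psi> (inv x))) * F x)"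
proof -
  define n where "n = card (carrier G)"
  define ev where "ev \<psi> = (\<Sum>x\<in>carrier G. fps_const (\<iota> (\<psi> (inv x))) * F x)" for \<psi>
  have "n > 0" unfolding n_def using fin by (auto simp: card_gt_0_iff)
  have g': "bij_betw g {0..<n} (carrier G)" using g by (simp add: n_def atLeast0LessThan)
  have gc: "g i \<in> carrier G" if "i < n" for i using g' that by (auto dest: bij_betwE)
  obtain e where e: "bij_betw e {0..<n} (characters G)"
    using ex_bij_betw_nat_finite[OF finite_characters[OF fin]] card_characters[OF fin]
    by (auto simp: n_def)
  have ec: "e k \<in> characters G" if "k < n" for k using e that by (auto dest: bij_betwE)
  have mult: "\<iota> (\<psi> (x \<otimes> y)) = \<iota> (\<psi> x) * \<iota> (\<psi> y)"
    if "\<psi> \<in> characters G" "x \<in> carrier G" "y \<in> carrier G" for \<psi> x y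
    using embedded_character_mult[OF \<iota> fin that(1,1,2,3)] that by (simp add: mem_characters_iff)
  define A where "A = mat n n (\<lambda>(i, j). F (g i \<otimes> inv g j))"
  define V where "V = mat n n (\<lambda>(i, k). fps_const (\<iota> (e k (g i))))"
  define W where "W = mat n n (\<lambda>(k, j). fps_const (\<iota> (e k (inv g j))))"
  define D where "D = mat n n (\<lambda>(i, k). if i = k then ev (e k) else 0)"
  have carr: "A \<in> carrier_mat n n" "V \<in> carrier_mat n n" "W \<in> carrier_mat n n" "D \<in> carrier_mat n n"
    by (simp_all add: A_def V_def W_def D_def)
  have VW: "V * W = of_nat n \<cdot>\<^sub>m 1\<^sub>m n"
  proof (rule eq_matI)
    fix i j assume "i < dim_row (of_nat n \<cdot>\<^sub>m 1\<^sub>m n :: 'f fps mat)" "j < dim_col (of_nat n \<cdot>\<^sub>m 1\<^sub>m n :: 'f fps mat)"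
    then have ij: "i < n" "j < n" by auto
    have "(V * W) $$ (i, j) = (\<Sum>k = 0..<n. fps_const (\<iota> (e k (g i))) * fps_const (\<iota> (e k (inv g j))))"
      using ij by (simp add: V_def W_def scalar_prod_def)
    also have "\<dots> = (\<Sum>k = 0..<n. fps_const (\<iota> (e k (g i \<otimes> inv g j))))"
      using ij by (intro sum.cong refl) (simp add: mult[OF ec] gc)
    also have "\<dots> = (\<Sum>\<psi>\<in>characters G. fps_const (\<iota> (\<psi> (g i \<otimes> inv g j))))"
      by (rule sum.reindex_bij_betw[OF e])
    also have "\<dots> = fps_const (\<Sum>\<psi>\<in>characters G. \<iota> (\<psi> (g i \<otimes> inv g j)))"
      by (simp add: fps_eq_iff fps_sum_nth)
    also have "(\<Sum>\<psi>\<in>characters G. \<iota> (\<psi> (g i \<otimes> inv g j))) =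
        (if g i \<otimes> inv g j = \<one> then of_nat n else 0)"
      using ij gc by (subst sum_characters[OF \<iota> fin]) (simp_all add: card_characters[OF fin] n_def)
    also have "g i \<otimes> inv g j = \<one> \<longleftrightarrow> g i = g j"
      using ij gc by (metis inv_equality inv_inv inv_closed r_inv)
    also have "g i = g j \<longleftrightarrow> i = j"
      using ij g' by (auto simp: bij_betw_def inj_on_def)
    finally show "(V * W) $$ (i, j) = (of_nat n \<cdot>\<^sub>m 1\<^sub>m n) $$ (i, j)"
      using ij by (simp add: fps_of_nat)
  qed (use carr in auto)
  have "Determinant.det V * Determinant.det W = of_nat n ^ n"
    using det_mult[OF carr(2,3)] by (simp add: VW)
  \<comment> \<open>\<open>n ^ n\<close> is nonzero because the characteristic is 0.\<close>
  then have V0: "Determinant.det V \<noteq> 0" using \<open>n > 0\<close> by auto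
  have AV: "A * V = V * D"
  proof (rule eq_matI)
    fix i k assume "i < dim_row (V * D)" "k < dim_col (V * D)"
    then have ik: "i < n" "k < n" using carr by auto
    note \<psi> = ec[OF ik(2)]
    note gi = gc[OF ik(1)]
    \<comment> \<open>Substituting \<open>y = x^-1 g_i\<close> turns \<open>F (g_i y^-1)\<close>
      into \<open>F x\<close> and splits the character value at \<open>y\<close> into the one at
      \<open>x^-1\<close>, which enters the eigenvalue, and the eigenvector entry at
      \<open>g_i\<close>.\<close>
    have bij: "bij_betw (\<lambda>x. inv x \<otimes> g i) (carrier G) (carrier G)"
      by (rule bij_betwI[where g = "\<lambda>y. g i \<otimes> inv y"])
        (use gi in \<open>auto simp: inv_mult m_ac\<close>)
    have "(A * V) $$ (i, k) = (\<Sum>j = 0..<n. F (g i \<otimes> inv g j) * fps_const (\<iota> (e k (g j))))"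
      using ik by (simp add: A_def V_def scalar_prod_def)
    also have "\<dots> = (\<Sum>y\<in>carrier G. F (g i \<otimes> inv y) * fps_const (\<iota> (e k y)))"
      by (rule sum.reindex_bij_betw[OF g'])
    also have "\<dots> = (\<Sum>x\<in>carrier G. F (g i \<otimes> inv (inv x \<otimes> g i)) * fps_const (\<iota> (e k (inv x \<otimes> g i))))"
      by (rule sum.reindex_bij_betw[OF bij, symmetric])
    also have "\<dots> = (\<Sum>x\<in>carrier G. fps_const (\<iota> (e k (g i))) * (fps_const (\<iota> (e k (inv x))) * F x))"
    proof (rule sum.cong[OF refl])
      fix x assume x: "x \<in> carrier G"
      have "g i \<otimes> inv (inv x \<otimes> g i) = x" using x gi by (simp add: inv_mult m_lcomm[of "g i" x])
      moreover have "fps_const (\<iota> (e k (inv x \<otimes> g i))) = fps_const (\<iota> (e k (inv x))) * fps_const (\<iota> (e k (g i)))"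
        using x gi by (simp add: mult[OF \<psi>])
      ultimately show "F (g i \<otimes> inv (inv x \<otimes> g i)) * fps_const (\<iota> (e k (inv x \<otimes> g i))) =
          fps_const (\<iota> (e k (g i))) * (fps_const (\<iota> (e k (inv x))) * F x)"
        by (simp only: mult_ac)
    qed
    also have "\<dots> = fps_const (\<iota> (e k (g i))) * ev (e k)" by (simp add: ev_def sum_distrib_left)
    also have "\<dots> = (V * D) $$ (i, k)"
      using ik by (simp add: V_def D_def scalar_prod_def if_distrib cong: if_cong)
    finally show "(A * V) $$ (i, k) = (V * D) $$ (i, k)" .
  qed (use carr in auto)
  have "Determinant.det A * Determinant.det V = Determinant.det V * Determinant.det D"
    unfolding det_mult[OF carr(1,2), symmetric] det_mult[OF carr(2,4), symmetric] AV ..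
  then have "Determinant.det A = Determinant.det D" using V0 by (metis mult.commute mult_cancel_left)
  also have "\<dots> = (\<Prod>k = 0..<n. ev (e k))"
    by (subst det_upper_triangular[OF _ carr(4)])
      (auto simp: prod_list_diag_prod D_def intro!: prod.cong)
  also have "\<dots> = (\<Prod>\<psi>\<in>characters G. ev \<psi>)" by (rule prod.reindex_bij_betw[OF e])
  finally show ?thesis by (simp add: A_def n_def ev_def)
qed

end

section \<open>Power series over the valuation ring\<close>

text \<open>This gives the exponent laws, for negative exponents too, from those of the binomial
  series.\<close>

lemma one_plus_T_powi_eq_fps_binomial:
  "(one_plus_T_powi b :: 'a::field_char_0 fps) = fps_binomial (of_int b)"
  by (simp add: one_plus_T_powi_def fps_eq_iff of_int_int_binomial_coeff)

lemma one_plus_T_powi_add: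
  "(one_plus_T_powi (a + b) :: 'a::field_char_0 fps) = one_plus_T_powi a * one_plus_T_powi b"
  by (simp add: one_plus_T_powi_eq_fps_binomial fps_binomial_add_mult)

lemma one_plus_T_powi_power:
  "(one_plus_T_powi a :: 'a::field_char_0 fps) ^ n = one_plus_T_powi (int n * a)"
  by (simp add: one_plus_T_powi_eq_fps_binomial fps_binomial_power)

lemma fps_of_poly_one_plus_T_power:
  assumes "b \<ge> 0"
  shows "fps_of_poly ([:1, 1:] ^ nat b) = (one_plus_T_powi b :: 'a::field_char_0 fps)"
proof -
  have "(of_int b :: 'a) = of_nat (nat b)" using assms by simp
  then show ?thesis
    by (simp add: one_plus_T_powi_eq_fps_binomial fps_binomial_of_nat fps_of_poly_power
      fps_of_poly_pCons)
qed

interpretation padic_int_to_bar: comm_ring_hom padic_int_to_bar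
  by unfold_locales
    (simp_all add: padic_int_to_bar_def Zero_fract_def[symmetric] One_fract_def[symmetric]
      flip: to_ac_add to_ac_mult)

text \<open>A ring homomorphism commutes with determinants; this carries the Iwasawa matrix to power
  series over the field that contains the embedded character values.\<close>

interpretation fps_to_bar: comm_ring_hom fps_to_bar
  by unfold_locales
    (simp_all add: fps_to_bar_def fps_eq_iff fps_mult_nth padic_int_to_bar.hom_add
      padic_int_to_bar.hom_mult padic_int_to_bar.hom_sum)

lemma fps_to_bar_one_plus_T_powi: "fps_to_bar (one_plus_T_powi b) = one_plus_T_powi b"
  by (simp add: fps_to_bar_def one_plus_T_powi_def padic_int_to_bar.hom_of_int)

lemma padic_int_abs_1: "padic_int_abs (1 :: 'p::prime_card padic_int) = 1"
  using padic_int_abs_mult[of 1 "1 :: 'p padic_int"] padic_int_abs_eq_0_iff[of "1 :: 'p padic_int"]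
  by simp

lemma padic_int_abs_le_1: "padic_int_abs (x :: 'p::prime_card padic_int) \<le> 1"
  using prime_gt_0_nat[OF prime_card[where 'a='p]]
  by (auto simp: padic_int_abs_def divide_le_eq_1 simp flip: of_nat_power)

text \<open>The generated field contains all \<open>\<ell>\<close>-adic numbers, and on them the
  extended absolute value is the \<open>\<ell>\<close>-adic one, which is at most 1 on
  integers.\<close>

lemma padic_int_to_bar_in_valuation_ring:
  "padic_int_to_bar x \<in> padic_valuation_ring (cyclotomic_padic_field n)"
proof -
  have "padic_int_to_bar x \<in> cyclotomic_padic_field n"
    unfolding cyclotomic_padic_field_def padic_int_to_bar_def
    by (rule generate_field.incl) simp
  moreover have "padic_bar_abs (padic_int_to_bar x) \<le> 1"
    by (simp add: padic_int_to_bar_def padic_bar_abs_to_ac padic_abs_Fract padic_int_abs_1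
      padic_int_abs_le_1)
  ultimately show ?thesis by (simp add: padic_valuation_ring_def)
qed

text \<open>The inverse has exponent \<open>- b\<close>, and both series have coefficients in the
  image of the rational integers.\<close>

lemma one_plus_T_powi_unit_over_valuation_ring:
  "(one_plus_T_powi b :: 'p::prime_card padic_bar fps)
     \<in> fps_units_over (padic_valuation_ring (cyclotomic_padic_field n))"
proof -
  have over: "(one_plus_T_powi c :: 'p padic_bar fps)
      \<in> fps_over (padic_valuation_ring (cyclotomic_padic_field n))" for c
  proof -
    have "(of_int k :: 'p padic_bar) \<in> padic_valuation_ring (cyclotomic_padic_field n)" for k
      using padic_int_to_bar_in_valuation_ring[of "of_int k" n]
      by (simp add: padic_int_to_bar.hom_of_int)
    then show ?thesis by (simp add: fps_over_def one_plus_T_powi_def)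
  qed
  have "one_plus_T_powi b * one_plus_T_powi (- b) = (one_plus_T_powi (b + - b) :: 'p padic_bar fps)"
    by (rule one_plus_T_powi_add[symmetric])
  also have "\<dots> = 1" by (simp add: one_plus_T_powi_eq_fps_binomial)
  finally have "one_plus_T_powi b * one_plus_T_powi (- b) = (1 :: 'p padic_bar fps)" .
  with over show ?thesis unfolding fps_units_over_def by blast
qed

section \<open>The factorisation of the Iwasawa polynomial\<close>

theorem theorem4p5:
  fixes G :: "('g, 'm) monoid_scheme"
    and S :: "'g set"
    and \<beta> :: "'g \<Rightarrow> 'p::prime_card padic_int"
    and \<iota> :: "complex \<Rightarrow> 'p padic_bar"
    and g :: "nat \<Rightarrow> 'g"
  assumes "comm_group G" and "finite (carrier G)"
    and "S \<subseteq> carrier G" and "generate G S = carrier G"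
    and "m_inv G ` S = S" and "\<one>\<^bsub>G\<^esub> \<notin> S"
    and "card S \<notin> {1, 2}"
    and "module.span (*) (\<beta> ` S) = UNIV"
    and "\<forall>s\<in>S. \<beta> (inv\<^bsub>G\<^esub> s) = - \<beta> s"
    and "\<beta> ` S \<subseteq> \<int>"
    and "\<exists>(m::nat) (h::nat \<Rightarrow> 'g). m > 0 \<and> (\<forall>i\<in>{1..m}. h i \<in> S) \<and> finprod G h {1..m} \<in> S \<and>
           \<not> of_nat CARD('p) dvd \<beta> (finprod G h {1..m}) - (\<Sum>i=1..m. \<beta> (h i))"
    and "bij_betw g {..<card (carrier G)} (carrier G)"
    and "algebraic_embedding \<iota>"
  shows "\<exists>u \<in> fps_units_over (padic_valuation_ring (cyclotomic_padic_field (card (carrier G)))).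
           fps_to_bar (iwasawa_poly (cayley_graph G S) (cayley_voltage G \<beta>) g) =
             (\<Prod>\<psi>\<in>characters G. fps_of_poly (character_poly \<iota> S \<beta> \<psi>)) * u"
proof -
  interpret comm_group G by fact
  note fin = assms(2) and SG = assms(3) and Sinv = assms(5) and \<iota> = assms(13)
  have finS: "finite S" using fin SG by (rule rev_finite_subset)
  \<comment> \<open>The noncongruence hypothesis exhibits a product lying in
    \<open>S\<close>.\<close>
  have "S \<noteq> {}" using assms(11) by auto
  define n where "n = card (carrier G)"
  define m where "m = beta_max S \<beta>"
  define b where "b s = padic_to_int (\<beta> s)" for s
  \<comment> \<open>The diagonal condition \<open>i = j\<close> is encoded as \<open>x = 1\<close>,
    because \<open>g_i g_j^-1 = 1\<close> exactly when \<open>i = j\<close>. The matrix thereby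
    takes the form required by \<open>group_determinant\<close>.\<close>
  define F :: "'g \<Rightarrow> 'p padic_bar fps" where
    "F x = of_nat (card S) * (if x = \<one>\<^bsub>G\<^esub> then 1 else 0) - (if x \<in> S then 1 else 0) * one_plus_T_powi (b x)" for x
  \<comment> \<open>\<open>padic_to_int\<close> is a definite description, so integrality of
    \<open>\<beta> s\<close> is what lets the sign pass through it.\<close>
  have b_inv: "b (inv\<^bsub>G\<^esub> s) = - b s" if s: "s \<in> S" for s
  proof -
    have "\<beta> s \<in> \<int>" using assms(10) s by blast
    then obtain z where "\<beta> s = of_int z" by (rule Ints_cases)
    then show ?thesis using assms(9) s unfolding b_def by (simp flip: of_int_minus)
  qed
  have b_le: "b s \<le> m" if "s \<in> S" for s
    unfolding m_def beta_max_def b_def using finS that by simp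
  \<comment> \<open>\<open>m\<close> bounds both \<open>b s\<close> and \<open>- b s\<close>.
    Together with \<open>b_le\<close> this ensures that \<open>nat\<close> truncates no exponent of
    \<open>character_poly\<close>.\<close>
  have "m \<ge> 0"
  proof -
    obtain s where s: "s \<in> S" using \<open>S \<noteq> {}\<close> by blast
    then have "inv\<^bsub>G\<^esub> s \<in> S" using Sinv by blast
    then show ?thesis using b_le[of s] b_le[of "inv\<^bsub>G\<^esub> s"] b_inv[OF s] s by simp
  qed
  have inv_bij: "bij_betw (m_inv G) S S"
    using Sinv SG by (auto simp: bij_betw_def inj_on_def subset_iff dest: inv_eq_imp_eq)
  have ev: "(\<Sum>x\<in>carrier G. fps_const (\<iota> (\<psi> (inv\<^bsub>G\<^esub> x))) * F x) =
      one_plus_T_powi (- m) * fps_of_poly (character_poly \<iota> S \<beta> \<psi>)" if \<psi>: "\<psi> \<in> characters G" for \<psi>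
  proof -
    have "(\<Sum>x\<in>carrier G. fps_const (\<iota> (\<psi> (inv\<^bsub>G\<^esub> x))) * F x) =
        (\<Sum>x\<in>carrier G. if x = \<one>\<^bsub>G\<^esub> then of_nat (card S) else 0) -
        (\<Sum>x\<in>carrier G. if x \<in> S then fps_const (\<iota> (\<psi> (inv\<^bsub>G\<^esub> x))) * one_plus_T_powi (b x) else 0)"
      unfolding sum_subtractf[symmetric]
      by (rule sum.cong[OF refl])
        (use \<iota> character_one[OF \<psi>] in \<open>auto simp: F_def algebraic_embedding_def algebra_simps\<close>)
    also have "(\<Sum>x\<in>carrier G. if x = \<one>\<^bsub>G\<^esub> then of_nat (card S) else (0 :: 'p padic_bar fps)) = of_nat (card S)"
      using fin by simp
    also have "(\<Sum>x\<in>carrier G. if x \<in> S then fps_const (\<iota> (\<psi> (inv\<^bsub>G\<^esub> x))) * one_plus_T_powi (b x) else 0) =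
        (\<Sum>s\<in>S. fps_const (\<iota> (\<psi> (inv\<^bsub>G\<^esub> s))) * one_plus_T_powi (b s))"
      using fin SG by (simp add: sum.If_cases Int_absorb1)
    \<comment> \<open>Inversion permutes \<open>S\<close> and negates \<open>b\<close>.\<close>
    also have "\<dots> = (\<Sum>s\<in>S. fps_const (\<iota> (\<psi> s)) * one_plus_T_powi (- b s))"
      by (subst sum.reindex_bij_betw[OF inv_bij, symmetric])
        (use SG b_inv in \<open>auto intro!: sum.cong\<close>)
    finally have lhs: "(\<Sum>x\<in>carrier G. fps_const (\<iota> (\<psi> (inv\<^bsub>G\<^esub> x))) * F x) =
        of_nat (card S) - (\<Sum>s\<in>S. fps_const (\<iota> (\<psi> s)) * one_plus_T_powi (- b s))" .
    have "fps_of_poly (character_poly \<iota> S \<beta> \<psi>) = of_nat (card S) * one_plus_T_powi m -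
        (\<Sum>s\<in>S. fps_const (\<iota> (\<psi> s)) * one_plus_T_powi (m - b s))"
      unfolding character_poly_def m_def[symmetric] b_def[symmetric] fps_of_poly_diff fps_of_poly_mult
        fps_of_poly_sum fps_of_poly_smult
      using b_le \<open>m \<ge> 0\<close> by (simp add: fps_of_poly_one_plus_T_power of_nat_poly fps_of_poly_const fps_of_nat)
    also have "one_plus_T_powi (- m) * \<dots> = of_nat (card S) * one_plus_T_powi (- m + m) -
        (\<Sum>s\<in>S. fps_const (\<iota> (\<psi> s)) * one_plus_T_powi (- m + (m - b s)))"
      unfolding one_plus_T_powi_add right_diff_distrib sum_distrib_left by (simp only: mult_ac)
    also have "\<dots> = of_nat (card S) - (\<Sum>s\<in>S. fps_const (\<iota> (\<psi> s)) * one_plus_T_powi (- b s))"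
      by (simp add: one_plus_T_powi_eq_fps_binomial[of 0])
    finally show ?thesis using lhs by simp
  qed
  have "fps_to_bar (iwasawa_poly (cayley_graph G S) (cayley_voltage G \<beta>) g) =
      Determinant.det (mat n n (\<lambda>(i, j). F (g i \<otimes>\<^bsub>G\<^esub> inv\<^bsub>G\<^esub> g j)))"
    unfolding iwasawa_poly_cayley[OF assms(1,3,5,12)] fps_to_bar.hom_det[symmetric] n_def[symmetric]
  proof (intro arg_cong[where f = Determinant.det] eq_matI)
    fix i j assume "i < dim_row (mat n n (\<lambda>(i, j). F (g i \<otimes>\<^bsub>G\<^esub> inv\<^bsub>G\<^esub> g j)))"
      "j < dim_col (mat n n (\<lambda>(i, j). F (g i \<otimes>\<^bsub>G\<^esub> inv\<^bsub>G\<^esub> g j)))"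
    then have ij: "i < n" "j < n" by auto
    then have gc: "g i \<in> carrier G" "g j \<in> carrier G"
      using assms(12) by (auto simp: n_def dest: bij_betwE)
    have "g i \<otimes>\<^bsub>G\<^esub> inv\<^bsub>G\<^esub> g j = \<one>\<^bsub>G\<^esub> \<longleftrightarrow> g i = g j"
      using gc by (metis inv_equality inv_inv inv_closed r_inv)
    also have "\<dots> \<longleftrightarrow> i = j"
      using ij assms(12) by (auto simp: n_def bij_betw_def inj_on_def)
    finally show "map_mat fps_to_bar (mat n n (\<lambda>(i, j).
        of_nat (card S) * (if i = j then 1 else 0) -
        (if g i \<otimes>\<^bsub>G\<^esub> inv\<^bsub>G\<^esub> g j \<in> S then 1 else 0) *
          one_plus_T_powi (padic_to_int (\<beta> (g i \<otimes>\<^bsub>G\<^esub> inv\<^bsub>G\<^esub> g j))))) $$ (i, j) =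
        mat n n (\<lambda>(i, j). F (g i \<otimes>\<^bsub>G\<^esub> inv\<^bsub>G\<^esub> g j)) $$ (i, j)"
      using ij by (simp add: F_def b_def fps_to_bar.hom_minus fps_to_bar.hom_mult
        fps_to_bar.hom_of_nat fps_to_bar_one_plus_T_powi)
  qed auto
  also have "\<dots> = (\<Prod>\<psi>\<in>characters G. one_plus_T_powi (- m) * fps_of_poly (character_poly \<iota> S \<beta> \<psi>))"
    unfolding n_def group_determinant[OF \<iota> fin assms(12)] by (rule prod.cong[OF refl ev])
  \<comment> \<open>Each of the \<open>n\<close> characters contributes one factor with exponent
    \<open>- m\<close>.\<close>
  also have "\<dots> = (\<Prod>\<psi>\<in>characters G. fps_of_poly (character_poly \<iota> S \<beta> \<psi>)) *
      one_plus_T_powi (int n * - m)"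
    by (simp add: prod.distrib card_characters[OF fin] n_def one_plus_T_powi_power mult.commute)
  finally show ?thesis using one_plus_T_powi_unit_over_valuation_ring by blast
qed

end
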